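(* For every topological space $(X,\tau)$ and every $A\subseteq X$, the set $\omega(A)$ is closed.
   Context: For a topological space $(X,\tau)$ and $A\subseteq X$, $\omega(A)$ is the set of $\omega$-accumulation points of $A$, i.e. of points $x\in X$ such that $|U\cap A|\ge\aleph_0$ for every open set $U$ containing $x$. *)

theory Defs
  imports "HOL-Analysis.Abstract_Topology"
begin

definition omega_acc_of :: "'a topology \<Rightarrow> 'a set \<Rightarrow> 'a set"
    (infixl \<open>omega'_acc'_of\<close> 80)
  where "X omega_acc_of A =
    {x \<in> topspace X. \<forall>U. openin X U \<and> x \<in> U \<longrightarrow> infinite (U \<inter> A)}"

end

theory Submission
  imports Defs
begin

theorem lemma6p13:
  fixes X :: "'a topology" and A :: "'a set"
  assumes "A \<subseteq> topspace X"
  shows "closedin X (X omega_acc_of A)"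
proof -
  let ?W = "\<Union>{U. openin X U \<and> finite (U \<inter> A)}"
  \<comment> \<open>An open set meeting \<open>A\<close> finitely witnesses that none of its points is an accumulation
    point, so all the witnesses together fill the complement exactly.\<close>
  have "X omega_acc_of A = topspace X - ?W"
    unfolding omega_acc_of_def by blast
  moreover have "openin X ?W"
    by (rule openin_Union) simp
  ultimately show ?thesis
    by (simp add: closedin_diff)
qed

end
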